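(* Let $(X,\|\cdot\|)$ be a real Banach space and let $T:X\to X$ be an enriched $\mathcal{A}'$-contraction. Then the fixed point problem concerning $T$ is well-posed.
   Context: Write $\mathbb{R}_+=[0,\infty)$. Let $\mathcal{A}'$ be the collection of all mappings $f:\mathbb{R}_+^3\to\mathbb{R}$ satisfying: ($\mathcal{A}'_1$) $f$ is continuous; ($\mathcal{A}'_2$) there exists $k\in[0,1)$ such that for all $r,s\in\mathbb{R}_+$: if $r\le f(r,s,s)$ or $r\le f(s,s,r)$, then $r\le ks$; ($\mathcal{A}'_3$) for all $\lambda>0$ and all $r,s,t\in\mathbb{R}_+$, $\lambda f(r,s,t)\le f(\lambda r,\lambda s,\lambda t)$; ($\mathcal{A}'_4$) for all $r,s,t,t_1\in\mathbb{R}_+$, if $t\le t_1$, then $f(r,s,t)\le f(r,s,t_1)$; ($\mathcal{A}'_5$) there exists $k\in[0,1)$ such that for all $r,s\in\mathbb{R}_+$: if $r\le f(s,0,r+s)$, then $r\le ks$; ($\mathcal{A}'_6$) for all $r\in\mathbb{R}_+$, if $r\le f(r,r,r)$, then $r=0$. Let $(X,\|\cdot\|)$ be a real Banach space. A mapping $T:X\to X$ is called an enriched $\mathcal{A}'$-contraction if there exist $b\in[0,\infty)$ and $f\in\mathcal{A}'$ such that $$\|b(u-v)+Tu-Tv\|\le f\big((b+1)\|u-v\|,\ \|(b+1)(u-v)+v-Tv\|,\ \|(b+1)(v-u)+u-Tu\|\big)$$ for all $u,v\in X$ with $u\ne v$. For a self-map $T$ of a metric space $(X,d)$, the fixed point problem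 concerning $T$ is called well-posed if (i) $T$ has a unique fixed point $p\in X$; and (ii) for any sequence $\{u_n\}$ in $X$ with $\lim_{n\to\infty}d(u_n,Tu_n)=0$, one has $\lim_{n\to\infty}d(u_n,p)=0$. Here $d(u,v)=\|u-v\|$. *)

theory Defs
  imports "HOL-Analysis.Analysis"
begin

text \<open>A mapping \<open>f : \<real>\<^sub>+\<^sup>3 \<rightarrow> \<real>\<close> is represented by a total function on \<open>real \<times> real \<times> real\<close>;
  its values outside the nonnegative octant are never constrained or used.\<close>

definition nonneg3 :: "(real \<times> real \<times> real) set" where
  "nonneg3 = {0..} \<times> {0..} \<times> {0..}"

definition class_A' :: "(real \<times> real \<times> real \<Rightarrow> real) set" where
  "class_A' = {f.
     continuous_on nonneg3 f \<and>
     (\<exists>k\<in>{0..<1}. \<forall>r\<ge>0. \<forall>s\<ge>0. r \<le> f (r, s, s) \<or> r \<le> f (s, s, r) \<longrightarrow> r \<le> k * s) \<and>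
     (\<forall>l>0. \<forall>r\<ge>0. \<forall>s\<ge>0. \<forall>t\<ge>0. l * f (r, s, t) \<le> f (l * r, l * s, l * t)) \<and>
     (\<forall>r\<ge>0. \<forall>s\<ge>0. \<forall>t\<ge>0. \<forall>t1\<ge>0. t \<le> t1 \<longrightarrow> f (r, s, t) \<le> f (r, s, t1)) \<and>
     (\<exists>k\<in>{0..<1}. \<forall>r\<ge>0. \<forall>s\<ge>0. r \<le> f (s, 0, r + s) \<longrightarrow> r \<le> k * s) \<and>
     (\<forall>r\<ge>0. r \<le> f (r, r, r) \<longrightarrow> r = 0)}"

definition enriched_A'_contraction :: "('a::real_normed_vector \<Rightarrow> 'a) \<Rightarrow> bool" where
  "enriched_A'_contraction T \<longleftrightarrow>
     (\<exists>b\<ge>0. \<exists>f\<in>class_A'. \<forall>u v. u \<noteq> v \<longrightarrow>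
        norm (b *\<^sub>R (u - v) + T u - T v) \<le>
        f ((b + 1) * norm (u - v),
           norm ((b + 1) *\<^sub>R (u - v) + v - T v),
           norm ((b + 1) *\<^sub>R (v - u) + u - T u)))"

definition well_posed_fixed_point :: "('a::metric_space \<Rightarrow> 'a) \<Rightarrow> bool" where
  "well_posed_fixed_point T \<longleftrightarrow>
     (\<exists>p. T p = p \<and> (\<forall>q. T q = q \<longrightarrow> q = p) \<and>
        (\<forall>u::nat \<Rightarrow> 'a. (\<lambda>n. dist (u n) (T (u n))) \<longlonglongrightarrow> 0 \<longrightarrow>
           (\<lambda>n. dist (u n) p) \<longlonglongrightarrow> 0))"

end

theory Submission
  imports Defs
begin

text \<open>
  Put \<open>l = 1 / (b + 1)\<close> and average: \<open>S u = u + l (T u - u)\<close>.  Since \<open>b u + T u = (b + 1) S u\<close> and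
  \<open>u - T u = (b + 1) (u - S u)\<close>, every norm in the enriched inequality carries a factor \<open>b + 1\<close>.
  Homogeneity of \<open>f\<close> removes it, and what is left is the purely metric condition
  \<open>dist (S u) (S v) \<le> f (dist u v, dist u (S v), dist v (S u))\<close> for \<open>u \<noteq> v\<close>.  The maps \<open>S\<close> and \<open>T\<close>
  have the same fixed points, and \<open>dist u (S u)\<close> is \<open>l\<close> times \<open>dist u (T u)\<close>, so well-posedness
  passes from \<open>S\<close> to \<open>T\<close>.

  For \<open>S\<close>, the axioms of the class divide the work.  Monotonicity in the third argument and
  the implication \<open>r \<le> f (s, 0, r + s) \<Longrightarrow> r \<le> k s\<close> make the steps of a Picard orbit shrink
  geometrically (\<open>displacement_shrinks\<close>), so the orbit converges.  Continuity of \<open>f\<close>, and the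
  implication \<open>r \<le> f (s, s, r) \<Longrightarrow> r \<le> k s\<close> at \<open>s = 0\<close>, make the limit a fixed point
  (\<open>limit_of_approximate_fixed_points\<close>).  The condition on \<open>f (r, r, r)\<close> gives uniqueness.  Finally
  \<open>r \<le> f (s, s, r) \<Longrightarrow> r \<le> k s\<close> at a fixed point \<open>p\<close> and arbitrary \<open>u\<close> gives
  \<open>dist (S u) p \<le> k dist u p\<close> (\<open>contracts_towards_fixed_point\<close>), whence
  \<open>(1 - k) dist u p \<le> dist u (S u)\<close>: a small displacement forces \<open>u\<close> to be near \<open>p\<close>.
\<close>

definition A'_contraction_wrt ::
  "(real \<times> real \<times> real \<Rightarrow> real) \<Rightarrow> ('a::metric_space \<Rightarrow> 'a) \<Rightarrow> bool" where
  "A'_contraction_wrt f S \<longleftrightarrow>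
     (\<forall>u v. u \<noteq> v \<longrightarrow> dist (S u) (S v) \<le> f (dist u v, dist u (S v), dist v (S u)))"

lemma class_A'D:
  assumes "f \<in> class_A'"
  shows class_A'_continuous: "continuous_on nonneg3 f"
    and class_A'_diagonal_bound:
      "\<exists>k\<in>{0..<1}. \<forall>r\<ge>0. \<forall>s\<ge>0. r \<le> f (r, s, s) \<or> r \<le> f (s, s, r) \<longrightarrow> r \<le> k * s"
    and class_A'_homogeneous:
      "\<forall>l>0. \<forall>r\<ge>0. \<forall>s\<ge>0. \<forall>t\<ge>0. l * f (r, s, t) \<le> f (l * r, l * s, l * t)"
    and class_A'_mono:
      "\<forall>r\<ge>0. \<forall>s\<ge>0. \<forall>t\<ge>0. \<forall>t1\<ge>0. t \<le> t1 \<longrightarrow> f (r, s, t) \<le> f (r, s, t1)"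
    and class_A'_orbit_bound:
      "\<exists>k\<in>{0..<1}. \<forall>r\<ge>0. \<forall>s\<ge>0. r \<le> f (s, 0, r + s) \<longrightarrow> r \<le> k * s"
    and class_A'_diagonal_zero: "\<forall>r\<ge>0. r \<le> f (r, r, r) \<longrightarrow> r = 0"
  by (insert assms[unfolded class_A'_def mem_Collect_eq], (elim conjE, assumption)+)

text \<open>Comparing \<open>S u\<close> with \<open>u\<close>, the second argument of \<open>f\<close> is \<open>dist (S u) (S u) = 0\<close>, and the third
  is at most the sum of two consecutive steps by the triangle inequality.\<close>

lemma displacement_shrinks:
  assumes f: "f \<in> class_A'" and S: "A'_contraction_wrt f S"
  obtains k where "0 \<le> k" "k < 1" "\<And>u. dist (S (S u)) (S u) \<le> k * dist (S u) u"
proof -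
  have mono: "f (r, s, t) \<le> f (r, s, t1)" if "0 \<le> r" "0 \<le> s" "0 \<le> t" "t \<le> t1" for r s t t1
    using class_A'_mono[OF f] that order_trans[OF that(3,4)] by blast
  obtain k where k: "0 \<le> k" "k < 1"
    and bound: "\<forall>r\<ge>0. \<forall>s\<ge>0. r \<le> f (s, 0, r + s) \<longrightarrow> r \<le> k * s"
    using class_A'_orbit_bound[OF f] by (meson atLeastLessThan_iff)
  have "dist (S (S u)) (S u) \<le> k * dist (S u) u" for u
  proof (cases "S u = u")
    case False
    have "dist (S (S u)) (S u) \<le> f (dist (S u) u, dist (S u) (S u), dist u (S (S u)))"
      using S False unfolding A'_contraction_wrt_def by blast
    also have "\<dots> \<le> f (dist (S u) u, 0, dist (S (S u)) (S u) + dist (S u) u)"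
      using mono[of "dist (S u) u" 0 "dist u (S (S u))"] dist_triangle[of "S (S u)" u "S u"]
      by (simp add: dist_commute)
    finally show ?thesis using bound zero_le_dist by blast
  qed simp
  with k that show thesis by blast
qed

text \<open>If \<open>S p \<noteq> p\<close>, then \<open>S (x n)\<close>, which tends to \<open>p\<close>, eventually differs from \<open>S p\<close>, so \<open>x n \<noteq> p\<close>
  and the contraction inequality is available.  In the limit it reads \<open>r \<le> f (0, 0, r)\<close> with
  \<open>r = dist (S p) p\<close>.\<close>

lemma limit_of_approximate_fixed_points:
  assumes f: "f \<in> class_A'" and S: "A'_contraction_wrt f S"
    and x: "x \<longlonglongrightarrow> p" and Sx: "(\<lambda>n. S (x n)) \<longlonglongrightarrow> p"
  shows "S p = p"
proof (rule ccontr)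
  assume neq: "S p \<noteq> p"
  have bound: "r \<le> 0" if "0 \<le> r" "r \<le> f (0, 0, r)" for r
  proof -
    obtain k where
      "\<forall>r\<ge>0. \<forall>s\<ge>0. r \<le> f (r, s, s) \<or> r \<le> f (s, s, r) \<longrightarrow> r \<le> k * s"
      using class_A'_diagonal_bound[OF f] by meson
    then have "r \<le> k * 0"
      using that order_refl[of "0::real"] by blast
    then show ?thesis by simp
  qed
  define a where "a n = (dist p (x n), dist p (S (x n)), dist (x n) (S p))" for n
  have "a \<longlonglongrightarrow> (dist p p, dist p p, dist p (S p))"
    unfolding a_def by (intro tendsto_intros x Sx)
  then have lim: "(\<lambda>n. f (a n)) \<longlonglongrightarrow> f (dist p p, dist p p, dist p (S p))"
    by (rule continuous_on_tendsto_compose[OF class_A'_continuous[OF f]])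
      (auto simp: a_def nonneg3_def)
  have "eventually (\<lambda>n. S (x n) \<noteq> S p) sequentially"
    using tendsto_imp_eventually_ne[OF Sx, of "S p"] neq by simp
  then have "eventually (\<lambda>n. dist (S p) (S (x n)) \<le> f (a n)) sequentially"
  proof eventually_elim
    case (elim n)
    then have "p \<noteq> x n" by auto
    then show ?case
      using S unfolding A'_contraction_wrt_def a_def by blast
  qed
  then have "dist (S p) p \<le> f (dist p p, dist p p, dist p (S p))"
    by (rule tendsto_le[OF sequentially_bot lim tendsto_dist[OF tendsto_const Sx]])
  then have "dist (S p) p \<le> 0"
    by (intro bound) (simp_all add: dist_commute)
  with neq show False by simp
qed

lemma fixed_point_unique:
  assumes f: "f \<in> class_A'" and S: "A'_contraction_wrt f S"
    and "S p = p" "S q = q"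
  shows "q = p"
proof (rule ccontr)
  assume "q \<noteq> p"
  then have "dist q p \<le> f (dist q p, dist q p, dist q p)"
    using S assms(3,4) unfolding A'_contraction_wrt_def by (metis dist_commute)
  then have "dist q p = 0"
    using class_A'_diagonal_zero[OF f] zero_le_dist[of q p] by blast
  with \<open>q \<noteq> p\<close> show False by simp
qed

text \<open>For \<open>v = p\<close> the first two arguments of \<open>f\<close> coincide and the third is \<open>dist (S u) p\<close>, the very
  quantity to be bounded.\<close>

lemma contracts_towards_fixed_point:
  assumes f: "f \<in> class_A'" and S: "A'_contraction_wrt f S" and p: "S p = p"
  obtains k where "0 \<le> k" "k < 1" "\<And>u. dist (S u) p \<le> k * dist u p"
proof -
  obtain k where k: "0 \<le> k" "k < 1"
    and bound: "\<forall>r\<ge>0. \<forall>s\<ge>0. r \<le> f (r, s, s) \<or> r \<le> f (s, s, r) \<longrightarrow> r \<le> k * s"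
    using class_A'_diagonal_bound[OF f] by (meson atLeastLessThan_iff)
  have "dist (S u) p \<le> k * dist u p" for u
  proof (cases "u = p")
    case False
    then have "dist (S u) p \<le> f (dist u p, dist u p, dist (S u) p)"
      using S p unfolding A'_contraction_wrt_def by (metis dist_commute)
    then show ?thesis using bound zero_le_dist by blast
  qed (simp add: p)
  with k that show thesis by blast
qed

lemma convergent_if_steps_shrink:
  fixes x :: "nat \<Rightarrow> 'a::banach"
  assumes k: "0 \<le> k" "k < 1"
    and step: "\<And>n. dist (x (Suc (Suc n))) (x (Suc n)) \<le> k * dist (x (Suc n)) (x n)"
  shows "convergent x"
proof -
  have bound: "norm (x (Suc n) - x n) \<le> k ^ n * dist (x 1) (x 0)" for n
  proof (induction n)
    case (Suc n)
    show ?case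
      using step[of n] mult_left_mono[OF Suc k(1)] by (simp add: dist_norm mult.assoc)
  qed (simp add: dist_norm)
  have "summable (\<lambda>n. k ^ n * dist (x 1) (x 0))"
    using k by (intro summable_mult2 summable_geometric) simp
  then have "summable (\<lambda>n. x (Suc n) - x n)"
    by (rule summable_comparison_test') (rule bound)
  then have "convergent (\<lambda>n. x n - x 0)"
    by (simp add: summable_iff_convergent sum_lessThan_telescope)
  then show ?thesis
    by (simp add: convergent_diff_const_right_iff)
qed

theorem A'_contraction_well_posed:
  fixes S :: "'a::banach \<Rightarrow> 'a"
  assumes f: "f \<in> class_A'" and S: "A'_contraction_wrt f S"
  shows "well_posed_fixed_point S"
proof -
  obtain k where k: "0 \<le> k" "k < 1"
    and shrink: "\<And>u. dist (S (S u)) (S u) \<le> k * dist (S u) u"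
    using displacement_shrinks[OF f S] by blast
  define x where "x n = (S ^^ n) 0" for n
  have x_Suc: "x (Suc n) = S (x n)" for n
    by (simp add: x_def)
  have "convergent x"
    by (rule convergent_if_steps_shrink[OF k]) (simp add: x_Suc shrink)
  then obtain p where lim: "x \<longlonglongrightarrow> p"
    by (auto simp: convergent_def)
  have "(\<lambda>n. S (x n)) \<longlonglongrightarrow> p"
    using LIMSEQ_Suc[OF lim] by (simp add: x_Suc)
  then have p: "S p = p"
    by (rule limit_of_approximate_fixed_points[OF f S lim])
  obtain c where c: "c < 1" and towards: "\<And>u. dist (S u) p \<le> c * dist u p"
    using contracts_towards_fixed_point[OF f S p] by blast
  \<comment> \<open>\<open>dist u p \<le> dist u (S u) + dist (S u) p \<le> dist u (S u) + c dist u p\<close>, solved for \<open>dist u p\<close>.\<close>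
  have near: "dist u p \<le> dist u (S u) / (1 - c)" for u
    using c towards[of u] dist_triangle[of u p "S u"]
    by (simp add: pos_le_divide_eq algebra_simps)
  have "(\<lambda>n. dist (u n) p) \<longlonglongrightarrow> 0" if "(\<lambda>n. dist (u n) (S (u n))) \<longlonglongrightarrow> 0" for u
  proof (rule tendsto_sandwich[OF _ _ tendsto_const])
    show "(\<lambda>n. dist (u n) (S (u n)) / (1 - c)) \<longlonglongrightarrow> 0"
      using tendsto_divide[OF that tendsto_const[of "1 - c"]] c by simp
  qed (auto simp: near)
  then show ?thesis
    unfolding well_posed_fixed_point_def
    using p fixed_point_unique[OF f S p] by blast
qed

lemma well_posed_averaged_iff:
  fixes T :: "'a::real_normed_vector \<Rightarrow> 'a"
  assumes "l \<noteq> 0"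
  shows "well_posed_fixed_point (\<lambda>u. u + l *\<^sub>R (T u - u)) \<longleftrightarrow> well_posed_fixed_point T"
proof -
  have "dist u (u + l *\<^sub>R (T u - u)) = \<bar>l\<bar> * dist u (T u)" for u
    using dist_commute[of u "T u"] by (simp add: dist_norm)
  moreover have "(\<lambda>n. \<bar>l\<bar> * g n) \<longlonglongrightarrow> 0 \<longleftrightarrow> g \<longlonglongrightarrow> 0" for g :: "nat \<Rightarrow> real"
    using tendsto_mult_left_iff[of "\<bar>l\<bar>" g 0] assms by simp
  ultimately show ?thesis
    using assms by (simp add: well_posed_fixed_point_def)
qed

text \<open>Multiplying the enriched inequality by \<open>l = 1 / (b + 1)\<close> turns its left side into
  \<open>dist (S u) (S v)\<close>, and homogeneity moves the same factor into the arguments of \<open>f\<close>, where it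
  cancels \<open>b + 1\<close>.\<close>

lemma averaged_A'_contraction:
  fixes T :: "'a::real_normed_vector \<Rightarrow> 'a"
  assumes f: "f \<in> class_A'" and b: "b \<ge> 0"
    and T: "\<And>u v. u \<noteq> v \<Longrightarrow> norm (b *\<^sub>R (u - v) + T u - T v) \<le>
        f ((b + 1) * norm (u - v),
           norm ((b + 1) *\<^sub>R (u - v) + v - T v),
           norm ((b + 1) *\<^sub>R (v - u) + u - T u))"
  shows "A'_contraction_wrt f (\<lambda>u. u + (1 / (b + 1)) *\<^sub>R (T u - u))"
  unfolding A'_contraction_wrt_def
proof (intro allI impI)
  fix u v :: 'a
  assume uv: "u \<noteq> v"
  define l where "l = 1 / (b + 1)"
  define S where "S w = w + l *\<^sub>R (T w - w)" for w
  have l: "l > 0" "l * (b + 1) = 1"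
    using b by (auto simp: l_def)
  have hom: "l * f (r, s, t) \<le> f (l * r, l * s, l * t)" if "0 \<le> r" "0 \<le> s" "0 \<le> t" for r s t
    using class_A'_homogeneous[OF f] l(1) that by blast
  have unscale: "l *\<^sub>R (b + 1) *\<^sub>R w = w" for w :: 'a
    by (simp add: l(2))
  have partial_unscale: "l *\<^sub>R b *\<^sub>R w = w - l *\<^sub>R w" for w :: 'a
    using unscale[of w] by (simp only: scaleR_add_left[of b] scaleR_add_right scaleR_one eq_diff_eq)
  have "l *\<^sub>R (b *\<^sub>R (u - v) + T u - T v) = (u - v) - l *\<^sub>R (u - v) + l *\<^sub>R T u - l *\<^sub>R T v"
    by (simp only: scaleR_add_right[of l] scaleR_diff_right[of l _ "T v"] partial_unscale)
  then have "S u - S v = l *\<^sub>R (b *\<^sub>R (u - v) + T u - T v)"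
    by (simp add: S_def scaleR_diff_right)
  then have left: "dist (S u) (S v) = l * norm (b *\<^sub>R (u - v) + T u - T v)"
    using l(1) by (simp add: dist_norm)
  have "l *\<^sub>R ((b + 1) *\<^sub>R (w - z) + z - T z) = (w - z) + l *\<^sub>R z - l *\<^sub>R T z" for w z
    by (simp only: scaleR_add_right[of l] scaleR_diff_right[of l] unscale)
  then have "w - S z = l *\<^sub>R ((b + 1) *\<^sub>R (w - z) + z - T z)" for w z
    by (simp add: S_def scaleR_diff_right)
  then have cross: "dist w (S z) = l * norm ((b + 1) *\<^sub>R (w - z) + z - T z)" for w z
    using l(1) by (simp add: dist_norm)
  have diag: "dist u v = l * ((b + 1) * norm (u - v))"
    using l(2) by (simp add: dist_norm flip: mult.assoc)
  have "dist (S u) (S v) \<le> l * f ((b + 1) * norm (u - v),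
           norm ((b + 1) *\<^sub>R (u - v) + v - T v),
           norm ((b + 1) *\<^sub>R (v - u) + u - T u))"
    unfolding left using l(1) by (intro mult_left_mono T uv) simp
  also have "\<dots> \<le> f (dist u v, dist u (S v), dist v (S u))"
    unfolding cross diag using b by (intro hom) auto
  finally have "dist (S u) (S v) \<le> f (dist u v, dist u (S v), dist v (S u))" .
  then show "dist (u + (1 / (b + 1)) *\<^sub>R (T u - u)) (v + (1 / (b + 1)) *\<^sub>R (T v - v))
      \<le> f (dist u v, dist u (v + (1 / (b + 1)) *\<^sub>R (T v - v)),
           dist v (u + (1 / (b + 1)) *\<^sub>R (T u - u)))"
    by (simp only: S_def l_def)
qed

theorem theorem3p16:
  fixes T :: "'a::banach \<Rightarrow> 'a"
  assumes "enriched_A'_contraction T"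
  shows "well_posed_fixed_point T"
proof -
  obtain b f where b: "b \<ge> 0" and f: "f \<in> class_A'"
    and T: "\<And>u v. u \<noteq> v \<Longrightarrow> norm (b *\<^sub>R (u - v) + T u - T v) \<le>
        f ((b + 1) * norm (u - v),
           norm ((b + 1) *\<^sub>R (u - v) + v - T v),
           norm ((b + 1) *\<^sub>R (v - u) + u - T u))"
    using assms unfolding enriched_A'_contraction_def by blast
  have "well_posed_fixed_point (\<lambda>u. u + (1 / (b + 1)) *\<^sub>R (T u - u))"
    by (rule A'_contraction_well_posed[OF f averaged_A'_contraction[OF f b T]])
  then show ?thesis
    using b by (subst (asm) well_posed_averaged_iff) auto
qed

end
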